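(* Let $y\sim\mathcal N(\beta_0,\sigma^2 I)$ in $\mathbb R^n$, let $\Delta\in\mathbb R^{r\times n}$ be an arbitrary linear operator, and let $M$ denote the maximum $\ell_2$ norm of the columns of $\Delta^\dagger$. Then for a tuning parameter value $\lambda=\Theta(M\sqrt{\log r})$, the generalized lasso estimate $$\hat\beta=\operatorname*{argmin}_{\beta\in\mathbb R^n}\ \tfrac12\|y-\beta\|_2^2+\lambda\|\Delta\beta\|_1$$ has average squared error $$\frac{\|\hat\beta-\beta_0\|_2^2}{n}=O_{\mathbb P}\left(\frac{\mathrm{nullity}(\Delta)}{n}+\frac{M\sqrt{\log r}}{n}\cdot\|\Delta\beta_0\|_1\right).$$
   Context: Asymptotics are as $n\to\infty$; $\sigma>0$ is a fixed constant, while $\Delta$, its number of rows $r$, the mean vector $\beta_0\in\mathbb R^n$, $M$ and $\lambda\ge 0$ may all depend on $n$. $\Delta^\dagger\in\mathbb R^{n\times r}$ is the Moore-Penrose pseudoinverse, and $\mathrm{nullity}(\Delta)$ is the dimension of the null space of $\Delta$. $X_n=O_{\mathbb P}(a_n)$ means that $X_n/a_n$ is bounded in probability. A statement made "with $\lambda=\Theta(a_n)$" means that the conclusion holds when the deterministic tuning parameter $\lambda$ is taken to be of exact order $a_n$, with a suitable choice of constant not depending on $n$. *)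

theory Defs
  imports "HOL-Probability.Probability" "Jordan_Normal_Form.Matrix_Kernel"
begin

unbundle no vec_syntax and no inner_syntax

definition l2_norm :: "real vec \<Rightarrow> real" where
  "l2_norm v = sqrt (v \<bullet> v)"

definition l1_norm :: "real vec \<Rightarrow> real" where
  "l1_norm v = (\<Sum>i<dim_vec v. \<bar>v $ i\<bar>)"

text \<open>The four Penrose conditions, which every real matrix \<open>A\<close> satisfies with exactly one \<open>B\<close>.\<close>

definition moore_penrose :: "real mat \<Rightarrow> real mat \<Rightarrow> bool" where
  "moore_penrose A B \<longleftrightarrow>
     B \<in> carrier_mat (dim_col A) (dim_row A) \<and>
     A * B * A = A \<and>
     B * A * B = B \<and>
     transpose_mat (A * B) = A * B \<and>
     transpose_mat (B * A) = B * A"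

text \<open>Only meaningful for matrices with at least one column.\<close>

definition max_col_norm :: "real mat \<Rightarrow> real" where
  "max_col_norm B = Max ((\<lambda>j. l2_norm (col B j)) ` {..<dim_col B})"

text \<open>\<open>Y \<sim> N(\<mu>, \<sigma>\<^sup>2 I)\<close> in dimension \<open>n\<close>: the coordinates of \<open>Y\<close> are independent and the \<open>i\<close>-th
  one is normal with mean \<open>\<mu>\<^sub>i\<close> and variance \<open>\<sigma>\<^sup>2\<close>. The second
  argument of \<^const>\<open>normal_density\<close> is the standard deviation, not the variance.\<close>

definition isotropic_normal ::
    "'w measure \<Rightarrow> nat \<Rightarrow> real vec \<Rightarrow> real \<Rightarrow> ('w \<Rightarrow> real vec) \<Rightarrow> bool" where
  "isotropic_normal P n \<mu> \<sigma> Y \<longleftrightarrow>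
     prob_space P \<and>
     (\<forall>\<omega>\<in>space P. Y \<omega> \<in> carrier_vec n) \<and>
     prob_space.indep_vars P (\<lambda>_. borel) (\<lambda>i \<omega>. Y \<omega> $ i) {..<n} \<and>
     (\<forall>i<n. distributed P lborel (\<lambda>\<omega>. Y \<omega> $ i) (\<lambda>x. ennreal (normal_density (\<mu> $ i) \<sigma> x)))"

definition gen_lasso_objective :: "real mat \<Rightarrow> real \<Rightarrow> real vec \<Rightarrow> real vec \<Rightarrow> real" where
  "gen_lasso_objective D lam y \<beta> = 1/2 * (l2_norm (y - \<beta>))\<^sup>2 + lam * l1_norm (D *\<^sub>v \<beta>)"

definition gen_lasso_estimate :: "real mat \<Rightarrow> real \<Rightarrow> real vec \<Rightarrow> real vec \<Rightarrow> bool" where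
  "gen_lasso_estimate D lam y \<beta> \<longleftrightarrow>
     is_arg_min (gen_lasso_objective D lam y) (\<lambda>b. b \<in> carrier_vec (dim_col D)) \<beta>"

text \<open>\<open>X\<^sub>n = O\<^sub>P(a\<^sub>n)\<close>, where \<open>X\<^sub>n\<close> lives on the probability space \<open>P\<^sub>n\<close>. The bound is multiplied out, so
  that it also makes sense, and is not void, when \<open>a\<^sub>n = 0\<close>. It is phrased as a lower bound on the
  probability of the good event because \<^const>\<open>measure\<close> is \<open>0\<close> on non-measurable sets: an upper
  bound on the bad event would hold trivially for them.\<close>

definition bigO_in_prob ::
    "(nat \<Rightarrow> 'w measure) \<Rightarrow> (nat \<Rightarrow> 'w \<Rightarrow> real) \<Rightarrow> (nat \<Rightarrow> real) \<Rightarrow> bool" where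
  "bigO_in_prob P X a \<longleftrightarrow>
     (\<forall>\<delta>>0. \<exists>K>0. \<forall>\<^sub>F n in sequentially.
        measure (P n) {\<omega> \<in> space (P n). \<bar>X n \<omega>\<bar> \<le> K * a n} \<ge> 1 - \<delta>)"

end

(* The minimality of the estimate b against b0, with v = b - b0 and noise e = y - b0, gives
     |v|^2 / 2 <= e . v + lam |D b0|_1 - lam |D b|_1.
   Let N = I - D^+ D be the orthogonal projection onto the null space of D.  Splitting
   e . v = (N e) . v + (D^+^T e) . (D v), the second part is absorbed by the penalty as soon as
   lam >= |D^+^T e|_oo, which leaves |v|^2 <= 4 |N e|^2 + 8 lam |D b0|_1.  The expectation of
   |N e|^2 is of the order of the trace of N, which is the nullity.

   With lam = 2 sigma M sqrt(ln r) the Gaussian tail bound for D^+^T e fails with probability at most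
   2 / r, which is not small when r stays bounded.  But then nullity(D) >= n - r is of order n, and the
   crude bound |v|^2 <= 4 |e|^2 + 4 lam |D b0|_1 is already good enough.

   The error event must also be measurable: the estimate is a Lipschitz function of y. *)

theory Submission
  imports Defs
begin

section \<open>Traces of projections\<close>

text \<open>Write the columns of \<open>P\<close> in a basis \<open>B\<close> of the kernel, with
  coefficients \<open>w\<close>. Because \<open>P\<close> fixes every \<open>b\<close> in
  \<open>B\<close>, linear independence forces the coefficient of \<open>b\<close> in
  \<open>P *\<^sub>v b\<close>, namely the sum of \<open>w j b * b $ j\<close> over
  \<open>j\<close>, to be 1. The trace is the sum of these coefficients over \<open>B\<close>, so it
  counts the basis.\<close>

lemma trace_projection_onto_kernel:
  fixes D P :: "real mat"
  assumes D: "D \<in> carrier_mat r n" and P: "P \<in> carrier_mat n n"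
    and DP: "D * P = 0\<^sub>m r n"
    and fix_ker: "\<And>v. v \<in> mat_kernel D \<Longrightarrow> P *\<^sub>v v = v"
  shows "(\<Sum>i<n. P $$ (i, i)) = real (kernel_dim D)"
proof -
  interpret kernel r n D by unfold_locales (rule D)
  obtain B where B: "finite B" "basis B"
    using kernel_basis_exists[OF D] by blast
  have Bk: "B \<subseteq> mat_kernel D" and gen: "span B = mat_kernel D" and indep: "\<not> lin_dep B"
    using B(2) unfolding Ker.basis_def by auto
  have dim: "kernel_dim D = card B"
    using Ker.dim_basis[OF B] by simp
  have "\<exists>a. col P j = lincomb a B" if j: "j < n" for j
  proof -
    have "D *\<^sub>v col P j = 0\<^sub>v r"
      using DP j D P by (metis col_mult2 col_zero)
    hence "col P j \<in> span B"
      unfolding gen using P j by (intro mat_kernelI[OF D]) auto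
    thus ?thesis using Ker.finite_span[OF B(1)] Bk by auto
  qed
  then obtain w where w: "\<And>j. j < n \<Longrightarrow> col P j = lincomb (w j) B" by metis
  have entry: "P $$ (i, j) = (\<Sum>b\<in>B. w j b * b $ i)" if "i < n" "j < n" for i j
    using lincomb_index[OF that(1) Bk, of "w j"] w[OF that(2)] that P by (metis carrier_matD index_col)
  have one: "(\<Sum>j<n. w j b * b $ j) = 1" if b: "b \<in> B" for b
  proof -
    \<comment> \<open>\<open>a\<close> holds the coefficients of \<open>P *\<^sub>v b - b\<close> in
      the basis \<open>B\<close>, so its linear combination vanishes.\<close>
    define a where "a b' = (\<Sum>j<n. w j b' * b $ j) - (if b' = b then 1 else 0)" for b'
    have bc: "b \<in> carrier_vec n" using b Bk mat_kernel[OF D] by auto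
    have "lincomb a B = 0\<^sub>v n"
    proof
      have "lincomb a B \<in> mat_kernel D" using Bk by (intro Ker.lincomb_closed) auto
      hence lc: "lincomb a B \<in> carrier_vec n" using mat_kernel[OF D] by auto
      thus "dim_vec (lincomb a B) = dim_vec (0\<^sub>v n)" by auto
      fix i assume "i < dim_vec (0\<^sub>v n)"
      hence i: "i < n" by simp
      have "lincomb a B $ i = (\<Sum>b'\<in>B. a b' * b' $ i)" by (rule lincomb_index[OF i Bk])
      also have "\<dots> = (\<Sum>b'\<in>B. \<Sum>j<n. w j b' * b $ j * b' $ i) - (\<Sum>b'\<in>B. if b' = b then b' $ i else 0)"
        unfolding sum_subtractf[symmetric]
        by (intro sum.cong) (auto simp: a_def sum_distrib_right left_diff_distrib)
      also have "(\<Sum>b'\<in>B. if b' = b then b' $ i else 0) = b $ i"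
        using b B(1) by simp
      also have "(\<Sum>b'\<in>B. \<Sum>j<n. w j b' * b $ j * b' $ i) = (\<Sum>j<n. P $$ (i, j) * b $ j)"
        by (subst sum.swap) (auto simp: entry i sum_distrib_left mult_ac intro!: sum.cong)
      also have "\<dots> = (P *\<^sub>v b) $ i"
        using P i bc by (auto simp: scalar_prod_def lessThan_atLeast0)
      also have "\<dots> = b $ i" using fix_ker b Bk by auto
      finally show "lincomb a B $ i = 0\<^sub>v n $ i" using i by simp
    qed
    hence "a \<in> B \<rightarrow> {0}"
      using Ker.not_lindepD[OF indep B(1) subset_refl, of a] by auto
    hence "a b = 0" using b by auto
    thus ?thesis by (simp add: a_def)
  qed
  have "(\<Sum>i<n. P $$ (i, i)) = (\<Sum>b\<in>B. \<Sum>i<n. w i b * b $ i)"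
    by (subst sum.swap) (auto simp: entry)
  also have "\<dots> = card B" using one by simp
  finally show ?thesis using dim by simp
qed

lemma row_square_sum_of_projection:
  fixes Q :: "real mat"
  assumes Q: "Q \<in> carrier_mat n n" "Q\<^sup>T = Q" "Q * Q = Q" and i: "i < n"
  shows "(\<Sum>j<n. (Q $$ (i, j))\<^sup>2) = Q $$ (i, i)"
proof -
  have "Q $$ (j, i) = Q $$ (i, j)" if "j < n" for j
    using Q(1,2) i that by (metis carrier_matD index_transpose_mat(1))
  hence "(\<Sum>j<n. (Q $$ (i, j))\<^sup>2) = (Q * Q) $$ (i, i)"
    using Q(1) i by (auto simp: scalar_prod_def power2_eq_square lessThan_atLeast0)
  thus ?thesis using Q by simp
qed

text \<open>The square of a diagonal entry q is one term in the sum of squares of its row, and that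
  sum equals q. So q^2 \<le> q, which gives q \<le> 1.\<close>

lemma trace_projection_le:
  fixes Q :: "real mat"
  assumes Q: "Q \<in> carrier_mat n n" "Q\<^sup>T = Q" "Q * Q = Q"
  shows "(\<Sum>i<n. Q $$ (i, i)) \<le> real n"
proof -
  have "Q $$ (i, i) \<le> 1" if i: "i < n" for i
  proof -
    have "(Q $$ (i, i))\<^sup>2 \<le> (\<Sum>j<n. (Q $$ (i, j))\<^sup>2)"
      using i by (intro member_le_sum) auto
    hence "(Q $$ (i, i))\<^sup>2 \<le> Q $$ (i, i)"
      using row_square_sum_of_projection[OF Q i] by simp
    thus ?thesis by (smt (verit) power2_eq_square mult_right_le_one_le mult_less_cancel_right1)
  qed
  hence "(\<Sum>i<n. Q $$ (i, i)) \<le> (\<Sum>i<n. 1)" by (intro sum_mono) auto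
  thus ?thesis by simp
qed

lemma trace_mult_comm:
  fixes A B :: "real mat"
  assumes A: "A \<in> carrier_mat n r" and B: "B \<in> carrier_mat r n"
  shows "(\<Sum>i<n. (A * B) $$ (i, i)) = (\<Sum>j<r. (B * A) $$ (j, j))"
proof -
  have "(\<Sum>i<n. (A * B) $$ (i, i)) = (\<Sum>i<n. \<Sum>j<r. A $$ (i, j) * B $$ (j, i))"
    using A B by (auto simp: scalar_prod_def lessThan_atLeast0 intro!: sum.cong)
  also have "\<dots> = (\<Sum>j<r. \<Sum>i<n. B $$ (j, i) * A $$ (i, j))"
    by (subst sum.swap) (simp add: mult.commute)
  also have "\<dots> = (\<Sum>j<r. (B * A) $$ (j, j))"
    using A B by (auto simp: scalar_prod_def lessThan_atLeast0 intro!: sum.cong)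
  finally show ?thesis .
qed

section \<open>Norms and scalar products\<close>

lemma scalar_prod_sum: "dim_vec w = n \<Longrightarrow> v \<bullet> w = (\<Sum>i<n. v $ i * w $ i)" for v w :: "real vec"
  by (simp add: scalar_prod_def lessThan_atLeast0)

lemma l2_norm_sq_sum: "(l2_norm v)\<^sup>2 = (\<Sum>i<dim_vec v. (v $ i)\<^sup>2)"
  by (simp add: l2_norm_def scalar_prod_def power2_eq_square lessThan_atLeast0 sum_nonneg)

lemma l2_norm_sq: "(l2_norm v)\<^sup>2 = v \<bullet> v"
  by (simp add: l2_norm_def scalar_prod_def sum_nonneg)

lemma l2_norm_nonneg: "0 \<le> l2_norm v"
  by (simp add: l2_norm_def scalar_prod_def sum_nonneg)

lemma l1_norm_nonneg: "0 \<le> l1_norm v"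
  by (simp add: l1_norm_def sum_nonneg)

lemma l1_norm_triangle_diff:
  assumes "v \<in> carrier_vec n" "w \<in> carrier_vec n"
  shows "l1_norm (v - w) \<le> l1_norm v + l1_norm w"
proof -
  have "l1_norm (v - w) = (\<Sum>i<n. \<bar>v $ i - w $ i\<bar>)" using assms by (simp add: l1_norm_def)
  also have "\<dots> \<le> (\<Sum>i<n. \<bar>v $ i\<bar> + \<bar>w $ i\<bar>)" by (intro sum_mono abs_triangle_ineq4)
  also have "\<dots> = l1_norm v + l1_norm w" using assms by (simp add: l1_norm_def sum.distrib)
  finally show ?thesis .
qed

lemma scalar_prod_le_max_l1:
  assumes w: "w \<in> carrier_vec n" and u: "\<And>j. j < n \<Longrightarrow> \<bar>u $ j\<bar> \<le> L"
  shows "u \<bullet> w \<le> L * l1_norm w"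
proof -
  have "u \<bullet> w = (\<Sum>j<n. u $ j * w $ j)" using w by (intro scalar_prod_sum) auto
  also have "\<dots> \<le> (\<Sum>j<n. L * \<bar>w $ j\<bar>)"
  proof (intro sum_mono)
    fix j assume "j \<in> {..<n}"
    hence "\<bar>u $ j\<bar> * \<bar>w $ j\<bar> \<le> L * \<bar>w $ j\<bar>" using u by (intro mult_right_mono) auto
    thus "u $ j * w $ j \<le> L * \<bar>w $ j\<bar>" by (metis abs_ge_self abs_mult order_trans)
  qed
  finally show ?thesis using w by (simp add: l1_norm_def sum_distrib_left)
qed

text \<open>Young's inequality with weight 1/4 on \<open>v\<close>: set against a term |v|^2 / 2 on
  the other side of an estimate, it leaves |v|^2 / 4. This is the source of the factors 4 and 8 in
  the error bounds.\<close>

lemma scalar_prod_le_young: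
  assumes v: "v \<in> carrier_vec n" and u: "u \<in> carrier_vec n"
  shows "u \<bullet> v \<le> (l2_norm u)\<^sup>2 + (l2_norm v)\<^sup>2 / 4"
proof -
  have "u \<bullet> v = (\<Sum>j<n. u $ j * v $ j)" using v by (intro scalar_prod_sum) auto
  also have "\<dots> \<le> (\<Sum>j<n. (u $ j)\<^sup>2 + (v $ j)\<^sup>2 / 4)"
  proof (intro sum_mono)
    fix j
    have "0 \<le> (u $ j - v $ j / 2)\<^sup>2" by simp
    thus "u $ j * v $ j \<le> (u $ j)\<^sup>2 + (v $ j)\<^sup>2 / 4"
      by (simp add: power2_eq_square algebra_simps)
  qed
  finally show ?thesis
    using u v by (simp add: l2_norm_sq_sum sum.distrib sum_divide_distrib)
qed

lemma l2_norm_sq_diff: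
  assumes "v \<in> carrier_vec n" "w \<in> carrier_vec n"
  shows "(l2_norm (v - w))\<^sup>2 = (l2_norm v)\<^sup>2 - 2 * (v \<bullet> w) + (l2_norm w)\<^sup>2"
proof -
  have "(v - w) \<bullet> (v - w) = v \<bullet> v - v \<bullet> w - (w \<bullet> v - w \<bullet> w)"
    using assms by (simp add: minus_scalar_prod_distrib[of _ n] scalar_prod_minus_distrib[of _ n])
  thus ?thesis using comm_scalar_prod[OF assms] by (simp add: l2_norm_sq)
qed

section \<open>The pseudoinverse and the projection onto the null space\<close>

locale moore_penrose_pair =
  fixes r n :: nat and D Dp :: "real mat"
  assumes D: "D \<in> carrier_mat r n" and mp: "moore_penrose D Dp"
begin

definition null_proj :: "real mat" where "null_proj = 1\<^sub>m n - Dp * D"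

lemma Dp: "Dp \<in> carrier_mat n r"
  using mp D by (auto simp: moore_penrose_def)

lemma
  shows DDpD: "D * Dp * D = D" and DpDDp: "Dp * D * Dp = Dp"
    and sym_DDp: "(D * Dp)\<^sup>T = D * Dp" and sym_DpD: "(Dp * D)\<^sup>T = Dp * D"
  using mp by (auto simp: moore_penrose_def)

lemma null_proj: "null_proj \<in> carrier_mat n n"
  using D Dp by (auto simp: null_proj_def)

lemma DpD: "Dp * D \<in> carrier_mat n n" using D Dp by auto
lemma DDp: "D * Dp \<in> carrier_mat r r" using D Dp by auto

lemma DpD_idem: "Dp * D * (Dp * D) = Dp * D"
  using assoc_mult_mat[OF DpD Dp D] by (simp only: DpDDp)

lemma DDp_idem: "D * Dp * (D * Dp) = D * Dp"
  using assoc_mult_mat[OF DDp D Dp] by (simp only: DDpD)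

lemma null_proj_sym: "null_proj\<^sup>T = null_proj"
proof -
  have "null_proj\<^sup>T = (1\<^sub>m n)\<^sup>T - (Dp * D)\<^sup>T"
    unfolding null_proj_def using DpD by (intro transpose_minus) auto
  thus ?thesis using sym_DpD by (simp add: null_proj_def)
qed

lemma null_proj_idem: "null_proj * null_proj = null_proj"
proof -
  have "null_proj * null_proj = null_proj * 1\<^sub>m n - null_proj * (Dp * D)"
    using null_proj DpD unfolding null_proj_def by (intro mult_minus_distrib_mat) auto
  also have "null_proj * (Dp * D) = 1\<^sub>m n * (Dp * D) - Dp * D * (Dp * D)"
    using DpD unfolding null_proj_def by (intro minus_mult_distrib_mat) auto
  also have "\<dots> = 0\<^sub>m n n"
    by (simp add: DpD_idem left_mult_one_mat[OF DpD] minus_r_inv_mat[OF DpD])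
  finally show ?thesis using null_proj by auto
qed

lemma D_null_proj: "D * null_proj = 0\<^sub>m r n"
proof -
  have "D * null_proj = D * 1\<^sub>m n - D * (Dp * D)"
    unfolding null_proj_def using D DpD by (intro mult_minus_distrib_mat) auto
  also have "D * (Dp * D) = D" using DDpD D Dp by simp
  finally show ?thesis using D by auto
qed

lemma null_proj_mult_vec:
  assumes "v \<in> carrier_vec n"
  shows "null_proj *\<^sub>v v = v - Dp *\<^sub>v (D *\<^sub>v v)"
  unfolding null_proj_def minus_mult_distrib_mat_vec[OF one_carrier_mat DpD assms]
  using assms by (simp add: assoc_mult_mat_vec[OF Dp D])

lemma trace_null_proj: "(\<Sum>i<n. null_proj $$ (i, i)) = real (kernel_dim D)"
proof (rule trace_projection_onto_kernel[OF D null_proj D_null_proj])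
  fix v assume "v \<in> mat_kernel D"
  with D have "v \<in> carrier_vec n" "D *\<^sub>v v = 0\<^sub>v r" by (auto simp: mat_kernel_def)
  thus "null_proj *\<^sub>v v = v"
    using null_proj_mult_vec Dp by auto
qed

text \<open>Times \<open>\<sigma>\<^sup>2\<close>, this sum is the expected squared norm of the
  projected noise. A symmetric idempotent matrix has squared Frobenius norm equal to its
  trace.\<close>

lemma frobenius_null_proj: "(\<Sum>i<n. \<Sum>j<n. (null_proj $$ (i, j))\<^sup>2) = real (kernel_dim D)"
  using row_square_sum_of_projection[OF null_proj null_proj_sym null_proj_idem] trace_null_proj
  by simp

text \<open>Rank-nullity through traces: the nullity is n minus the trace of \<open>Dp * D\<close>.
  Cyclicity replaces that trace by the one of the projection \<open>D * Dp\<close>, which has only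
  \<open>r\<close> diagonal entries, each at most 1.\<close>

lemma kernel_dim_ge: "real n \<le> real (kernel_dim D) + real r"
proof -
  have "(\<Sum>i<n. null_proj $$ (i, i)) = real n - (\<Sum>i<n. (Dp * D) $$ (i, i))"
    using D Dp by (simp add: null_proj_def sum_subtractf)
  moreover have "(\<Sum>i<n. (Dp * D) $$ (i, i)) = (\<Sum>j<r. (D * Dp) $$ (j, j))"
    by (rule trace_mult_comm[OF Dp D])
  moreover have "(\<Sum>j<r. (D * Dp) $$ (j, j)) \<le> real r" by (rule trace_projection_le[OF DDp sym_DDp DDp_idem])
  ultimately show ?thesis using trace_null_proj by linarith
qed

text \<open>Split \<open>v\<close> into its projection onto the null space and
  \<open>Dp *\<^sub>v (D *\<^sub>v v)\<close>, then move \<open>null_proj\<close> (symmetric) and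
  \<open>Dp\<close> over to \<open>e\<close>.\<close>

lemma scalar_prod_decompose:
  assumes e: "e \<in> carrier_vec n" and v: "v \<in> carrier_vec n"
  shows "e \<bullet> v = (null_proj *\<^sub>v e) \<bullet> v + (Dp\<^sup>T *\<^sub>v e) \<bullet> (D *\<^sub>v v)"
proof -
  have Dv: "D *\<^sub>v v \<in> carrier_vec r" using D v by auto
  have *: "Dp *\<^sub>v (D *\<^sub>v v) \<in> carrier_vec n" using Dp Dv by auto
  have "(null_proj *\<^sub>v e) \<bullet> v = e \<bullet> (null_proj *\<^sub>v v)"
    using transpose_vec_mult_scalar[OF null_proj v e] by (simp add: null_proj_sym)
  also have "\<dots> = e \<bullet> v - e \<bullet> (Dp *\<^sub>v (D *\<^sub>v v))"
    unfolding null_proj_mult_vec[OF v] by (rule scalar_prod_minus_distrib[OF e v *])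
  finally show ?thesis using transpose_vec_mult_scalar[OF Dp Dv e] by simp
qed

end

section \<open>Deterministic error bounds for a minimizer\<close>

lemma gen_lasso_estimateD:
  assumes "gen_lasso_estimate D lam y b" "D \<in> carrier_mat r n"
  shows "b \<in> carrier_vec n"
    and "\<And>b'. b' \<in> carrier_vec n \<Longrightarrow> gen_lasso_objective D lam y b \<le> gen_lasso_objective D lam y b'"
  using assms by (auto simp: gen_lasso_estimate_def is_arg_min_def not_less)

text \<open>Compare the objective at \<open>b\<close> and at \<open>b0\<close>, and expand the
  square of \<open>y - b = (y - b0) - (b - b0)\<close>: the common term |y - b0|^2 / 2
  cancels.\<close>

lemma gen_lasso_basic_inequality:
  assumes est: "gen_lasso_estimate D lam y b" and D: "D \<in> carrier_mat r n"
    and y: "y \<in> carrier_vec n" and b0: "b0 \<in> carrier_vec n"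
  shows "(l2_norm (b - b0))\<^sup>2 / 2 + lam * l1_norm (D *\<^sub>v b)
    \<le> (y - b0) \<bullet> (b - b0) + lam * l1_norm (D *\<^sub>v b0)"
proof -
  note b = gen_lasso_estimateD(1)[OF est D]
  have "y - b = (y - b0) - (b - b0)" using y b b0 by auto
  hence "(l2_norm (y - b))\<^sup>2 = (l2_norm (y - b0))\<^sup>2 - 2 * ((y - b0) \<bullet> (b - b0)) + (l2_norm (b - b0))\<^sup>2"
    using y b b0 by (simp add: l2_norm_sq_diff[of _ n])
  thus ?thesis
    using gen_lasso_estimateD(2)[OF est D b0] unfolding gen_lasso_objective_def by linarith
qed

text \<open>Young's inequality is applied to the whole noise and the penalty of \<open>b\<close> is
  dropped. The noise is not compared with \<open>lam\<close>, so this serves the regime of few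
  rows.\<close>

lemma gen_lasso_crude_bound:
  assumes est: "gen_lasso_estimate D lam y b" and D: "D \<in> carrier_mat r n"
    and y: "y \<in> carrier_vec n" and b0: "b0 \<in> carrier_vec n" and lam: "0 \<le> lam"
  shows "(l2_norm (b - b0))\<^sup>2 \<le> 4 * (l2_norm (y - b0))\<^sup>2 + 4 * lam * l1_norm (D *\<^sub>v b0)"
proof -
  note b = gen_lasso_estimateD(1)[OF est D]
  have "(y - b0) \<bullet> (b - b0) \<le> (l2_norm (y - b0))\<^sup>2 + (l2_norm (b - b0))\<^sup>2 / 4"
    using b y b0 by (intro scalar_prod_le_young[of _ n]) auto
  moreover have "0 \<le> lam * l1_norm (D *\<^sub>v b)" using lam l1_norm_nonneg by simp
  ultimately show ?thesis using gen_lasso_basic_inequality[OF est D y b0] by linarith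
qed

text \<open>The noise on the row side costs at most \<open>lam\<close> times the l1 norm of
  \<open>D *\<^sub>v b - D *\<^sub>v b0\<close>. By the triangle inequality the part from
  \<open>b\<close> cancels the penalty on the left, and the part from \<open>b0\<close> doubles the
  penalty on the right. Absorbing |b - b0|^2 / 4 then multiplies everything by 4.\<close>

lemma (in moore_penrose_pair) gen_lasso_oracle_bound:
  assumes est: "gen_lasso_estimate D lam y b"
    and y: "y \<in> carrier_vec n" and b0: "b0 \<in> carrier_vec n"
    and lam: "0 \<le> lam"
    and noise: "\<And>j. j < r \<Longrightarrow> \<bar>(Dp\<^sup>T *\<^sub>v (y - b0)) $ j\<bar> \<le> lam"
  shows "(l2_norm (b - b0))\<^sup>2 \<le> 4 * (l2_norm (null_proj *\<^sub>v (y - b0)))\<^sup>2 + 8 * lam * l1_norm (D *\<^sub>v b0)"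
proof -
  note b = gen_lasso_estimateD(1)[OF est D]
  have v: "b - b0 \<in> carrier_vec n" and e: "y - b0 \<in> carrier_vec n" using b y b0 by auto
  have "(null_proj *\<^sub>v (y - b0)) \<bullet> (b - b0)
      \<le> (l2_norm (null_proj *\<^sub>v (y - b0)))\<^sup>2 + (l2_norm (b - b0))\<^sup>2 / 4"
    using v e null_proj by (intro scalar_prod_le_young[of _ n]) auto
  moreover have "(Dp\<^sup>T *\<^sub>v (y - b0)) \<bullet> (D *\<^sub>v (b - b0)) \<le> lam * l1_norm (D *\<^sub>v (b - b0))"
    by (rule scalar_prod_le_max_l1[OF mult_mat_vec_carrier[OF D v] noise])
  moreover have "lam * l1_norm (D *\<^sub>v (b - b0)) \<le> lam * (l1_norm (D *\<^sub>v b) + l1_norm (D *\<^sub>v b0))"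
    unfolding mult_minus_distrib_mat_vec[OF D b b0]
    by (intro mult_left_mono[OF _ lam] l1_norm_triangle_diff[of _ r] mult_mat_vec_carrier[OF D] b b0)
  hence "lam * l1_norm (D *\<^sub>v (b - b0)) \<le> lam * l1_norm (D *\<^sub>v b) + lam * l1_norm (D *\<^sub>v b0)"
    by (simp only: distrib_left)
  ultimately show ?thesis
    using gen_lasso_basic_inequality[OF est D y b0] scalar_prod_decompose[OF e v] by linarith
qed

section \<open>Measurability from a bound on oscillation\<close>

text \<open>No measurable dependence of \<open>d\<close> on the \<open>X i\<close> is assumed: the sublevel sets of \<open>d\<close> are preimages of
  open sets because \<open>d\<close> factors through a continuous function on the range of the \<open>X i\<close>.\<close>

lemma borel_measurable_if_oscillation_dominated:
  fixes d :: "'w \<Rightarrow> real" and X :: "nat \<Rightarrow> 'w \<Rightarrow> real"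
  assumes X: "\<And>i. i < n \<Longrightarrow> X i \<in> borel_measurable M"
    and osc: "\<And>\<omega> \<omega>'. \<omega> \<in> space M \<Longrightarrow> \<omega>' \<in> space M \<Longrightarrow> d \<omega> - d \<omega>' \<le> (\<Sum>i<n. \<bar>X i \<omega> - X i \<omega>'\<bar>)"
  shows "d \<in> borel_measurable M"
proof (rule borel_measurableI_less)
  fix c
  \<comment> \<open>Padding with 0 turns the finitely many \<open>X i\<close> into one map to
    \<open>nat \<Rightarrow> real\<close>, whose measurability can be checked coordinate by
    coordinate.\<close>
  define \<Phi> where "\<Phi> \<omega> = (\<lambda>i. if i < n then X i \<omega> else 0)" for \<omega>
  \<comment> \<open>\<open>U\<close> is a union of open sets, one for each outcome in the sublevel
    set. Its preimage contains the sublevel set by taking \<open>\<omega>' = \<omega>\<close>, and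
    is contained in it by \<open>osc\<close>.\<close>
  define U where "U = (\<Union>\<omega>'\<in>{\<omega>'\<in>space M. d \<omega>' < c}. {x :: nat \<Rightarrow> real. d \<omega>' + (\<Sum>i<n. \<bar>x i - X i \<omega>'\<bar>) < c})"
  have cont: "continuous_on UNIV (\<lambda>x :: nat \<Rightarrow> real. x i)" for i by simp
  have "open U"
    unfolding U_def
    by (intro open_UN ballI open_Collect_less continuous_intros cont)
  hence U: "U \<in> sets borel" by simp
  have \<Phi>: "\<Phi> \<in> borel_measurable M"
  proof (rule measurable_coordinatewise_then_product)
    show "(\<lambda>\<omega>. \<Phi> \<omega> i) \<in> borel_measurable M" for i
      using X by (cases "i < n") (auto simp: \<Phi>_def)
  qed
  have "{\<omega> \<in> space M. d \<omega> < c} = \<Phi> -` U \<inter> space M"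
  proof (intro equalityI subsetI)
    fix \<omega> assume "\<omega> \<in> {\<omega> \<in> space M. d \<omega> < c}"
    thus "\<omega> \<in> \<Phi> -` U \<inter> space M" by (auto simp: U_def \<Phi>_def intro!: bexI[of _ \<omega>] exI[of _ \<omega>])
  next
    fix \<omega> assume "\<omega> \<in> \<Phi> -` U \<inter> space M"
    then obtain \<omega>' where "\<omega> \<in> space M" "\<omega>' \<in> space M" "d \<omega>' + (\<Sum>i<n. \<bar>X i \<omega> - X i \<omega>'\<bar>) < c"
      by (auto simp: U_def \<Phi>_def)
    thus "\<omega> \<in> {\<omega> \<in> space M. d \<omega> < c}" using osc[of \<omega> \<omega>'] by auto
  qed
  thus "{\<omega> \<in> space M. d \<omega> < c} \<in> sets M" using measurable_sets[OF \<Phi> U] by simp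
qed

section \<open>Linear forms in Gaussian noise: tails and second moments\<close>

text \<open>Completing the square: the exponential tilt of a normal density is a constant times the
  normal density with mean shifted by \<open>s * \<sigma>\<^sup>2\<close>, which integrates to
  1.\<close>

lemma nn_integral_normal_mgf:
  assumes "\<sigma> > 0"
  shows "(\<integral>\<^sup>+x. ennreal (normal_density \<mu> \<sigma> x) * ennreal (exp (s * (x - \<mu>))) \<partial>lborel)
    = ennreal (exp (s\<^sup>2 * \<sigma>\<^sup>2 / 2))"
proof -
  have eq: "normal_density \<mu> \<sigma> x * exp (s * (x - \<mu>))
      = exp (s\<^sup>2 * \<sigma>\<^sup>2 / 2) * normal_density (\<mu> + s * \<sigma>\<^sup>2) \<sigma> x" for x
  proof -
    have "- (x - \<mu>)\<^sup>2 / (2 * \<sigma>\<^sup>2) + s * (x - \<mu>)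
        = s\<^sup>2 * \<sigma>\<^sup>2 / 2 + - (x - (\<mu> + s * \<sigma>\<^sup>2))\<^sup>2 / (2 * \<sigma>\<^sup>2)"
      using assms by (simp add: field_simps power2_eq_square)
    thus ?thesis by (simp add: normal_density_def exp_add[symmetric])
  qed
  have "(\<integral>\<^sup>+x. ennreal (normal_density \<mu> \<sigma> x) * ennreal (exp (s * (x - \<mu>))) \<partial>lborel)
     = (\<integral>\<^sup>+x. ennreal (exp (s\<^sup>2 * \<sigma>\<^sup>2 / 2)) * ennreal (normal_density (\<mu> + s * \<sigma>\<^sup>2) \<sigma> x) \<partial>lborel)"
    by (simp add: ennreal_mult'[symmetric] eq)
  also have "\<dots> = ennreal (exp (s\<^sup>2 * \<sigma>\<^sup>2 / 2)) * (\<integral>\<^sup>+x. ennreal (normal_density (\<mu> + s * \<sigma>\<^sup>2) \<sigma> x) \<partial>lborel)"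
    by (intro nn_integral_cmult) simp
  also have "(\<integral>\<^sup>+x. ennreal (normal_density (\<mu> + s * \<sigma>\<^sup>2) \<sigma> x) \<partial>lborel) = 1"
    using assms by (subst nn_integral_eq_integral) (auto simp: integral_normal_density)
  finally show ?thesis by simp
qed

text \<open>Reduces second moments to the moment generating function. For x \<ge> 0 the quadratic
  Taylor bound of \<open>exp x\<close> suffices; the term \<open>exp (- x)\<close> covers the other
  sign.\<close>

lemma square_le_two_exp: "x\<^sup>2 \<le> 2 * (exp x + exp (- x))" for x :: real
proof -
  have "y\<^sup>2 \<le> 2 * exp y" if "0 \<le> y" for y :: real
    using exp_lower_Taylor_quadratic[OF that] that by (smt (verit) field_sum_of_halves)
  from this[of x] this[of "-x"] show ?thesis
    by (cases "0 \<le> x") (auto simp: distrib_left intro: order_trans add_increasing add_increasing2)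
qed

locale normal_noise =
  fixes P :: "'w measure" and n :: nat and \<mu> :: "real vec" and \<sigma> :: real and Y :: "'w \<Rightarrow> real vec"
  assumes Y: "isotropic_normal P n \<mu> \<sigma> Y" and \<mu>: "\<mu> \<in> carrier_vec n" and \<sigma>: "\<sigma> > 0"
begin

sublocale prob_space P using Y by (simp add: isotropic_normal_def)

lemma Y_carrier: "\<omega> \<in> space P \<Longrightarrow> Y \<omega> \<in> carrier_vec n"
  using Y by (simp add: isotropic_normal_def)

lemma Y_distributed: "i < n \<Longrightarrow> distributed P lborel (\<lambda>\<omega>. Y \<omega> $ i) (\<lambda>x. ennreal (normal_density (\<mu> $ i) \<sigma> x))"
  using Y by (simp add: isotropic_normal_def)

lemma Y_measurable: "i < n \<Longrightarrow> (\<lambda>\<omega>. Y \<omega> $ i) \<in> borel_measurable P"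
  using distributed_measurable[OF Y_distributed] by simp

text \<open>Each coordinate of a matrix applied to the noise \<open>Y \<omega> - \<mu>\<close> has
  this form, with a row of the matrix as \<open>a\<close>.\<close>

definition lin :: "(nat \<Rightarrow> real) \<Rightarrow> 'w \<Rightarrow> real" where
  "lin a \<omega> = (\<Sum>i<n. a i * (Y \<omega> $ i - \<mu> $ i))"

lemma lin_measurable [measurable]: "lin a \<in> borel_measurable P"
  unfolding lin_def [abs_def] using Y_measurable by (intro borel_measurable_sum) auto

lemma lin_scale: "lin (\<lambda>i. s * a i) \<omega> = s * lin a \<omega>"
  by (simp add: lin_def sum_distrib_left mult.assoc)

text \<open>The exponential of the sum is a product of functions of independent coordinates, so the
  integral factors into one-dimensional normal ones.\<close>

lemma mgf: "(\<integral>\<^sup>+\<omega>. ennreal (exp (s * lin a \<omega>)) \<partial>P) = ennreal (exp (s\<^sup>2 * (\<Sum>i<n. (a i)\<^sup>2) * \<sigma>\<^sup>2 / 2))"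
proof -
  let ?g = "\<lambda>i x. ennreal (exp (s * a i * (x - \<mu> $ i)))"
  have "indep_vars (\<lambda>_. borel) (\<lambda>i \<omega>. Y \<omega> $ i) {..<n}"
    using Y by (simp add: isotropic_normal_def)
  hence indep: "indep_vars (\<lambda>_. borel) (\<lambda>i \<omega>. ?g i (Y \<omega> $ i)) {..<n}"
    by (rule indep_vars_compose2) measurable
  have "(\<integral>\<^sup>+\<omega>. ennreal (exp (s * lin a \<omega>)) \<partial>P) = (\<integral>\<^sup>+\<omega>. (\<Prod>i<n. ?g i (Y \<omega> $ i)) \<partial>P)"
    by (simp add: lin_def exp_sum sum_distrib_left prod_ennreal mult.assoc)
  also have "\<dots> = (\<Prod>i<n. \<integral>\<^sup>+\<omega>. ?g i (Y \<omega> $ i) \<partial>P)"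
    using indep by (intro indep_vars_nn_integral) auto
  also have "\<dots> = (\<Prod>i<n. ennreal (exp ((s * a i)\<^sup>2 * \<sigma>\<^sup>2 / 2)))"
  proof (intro prod.cong refl)
    fix i assume "i \<in> {..<n}"
    hence "(\<integral>\<^sup>+\<omega>. ?g i (Y \<omega> $ i) \<partial>P)
        = (\<integral>\<^sup>+x. ennreal (normal_density (\<mu> $ i) \<sigma> x) * ?g i x \<partial>lborel)"
      by (intro distributed_nn_integral[symmetric] Y_distributed) auto
    thus "(\<integral>\<^sup>+\<omega>. ?g i (Y \<omega> $ i) \<partial>P) = ennreal (exp ((s * a i)\<^sup>2 * \<sigma>\<^sup>2 / 2))"
      using nn_integral_normal_mgf[OF \<sigma>] by simp
  qed
  also have "\<dots> = ennreal (exp (\<Sum>i<n. (s * a i)\<^sup>2 * \<sigma>\<^sup>2 / 2))"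
    by (simp add: prod_ennreal exp_sum)
  also have "(\<Sum>i<n. (s * a i)\<^sup>2 * \<sigma>\<^sup>2 / 2) = s\<^sup>2 * (\<Sum>i<n. (a i)\<^sup>2) * \<sigma>\<^sup>2 / 2"
    by (simp add: power_mult_distrib sum_distrib_left sum_distrib_right sum_divide_distrib)
  finally show ?thesis .
qed

lemma upper_tail:
  assumes a: "(\<Sum>i<n. (a i)\<^sup>2) \<le> s\<^sup>2" and s: "s > 0" and l: "l > 0"
  shows "prob {\<omega> \<in> space P. l \<le> lin a \<omega>} \<le> exp (- l\<^sup>2 / (2 * \<sigma>\<^sup>2 * s\<^sup>2))"
proof -
  \<comment> \<open>Chernoff's bound with the minimizer \<open>t\<close> of the exponent
    \<open>- t * l + t\<^sup>2 * s\<^sup>2 * \<sigma>\<^sup>2 / 2\<close>.\<close>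
  define t where "t = l / (\<sigma>\<^sup>2 * s\<^sup>2)"
  have t: "t > 0" using \<sigma> s l by (simp add: t_def)
  have "emeasure P {\<omega> \<in> space P. l \<le> lin a \<omega>}
      \<le> ennreal (exp (- t * l)) * (\<integral>\<^sup>+\<omega>. ennreal (exp (t * lin a \<omega>)) * indicator (space P) \<omega> \<partial>P)"
    using Chernoff_ineq_nn_integral_ge[OF t, of "space P" P "lin a" l] by simp
  also have "(\<integral>\<^sup>+\<omega>. ennreal (exp (t * lin a \<omega>)) * indicator (space P) \<omega> \<partial>P)
      = ennreal (exp (t\<^sup>2 * (\<Sum>i<n. (a i)\<^sup>2) * \<sigma>\<^sup>2 / 2))"
    unfolding mgf[symmetric] by (intro nn_integral_cong) auto
  also have "ennreal (exp (- t * l)) * \<dots> = ennreal (exp (- t * l + t\<^sup>2 * (\<Sum>i<n. (a i)\<^sup>2) * \<sigma>\<^sup>2 / 2))"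
    by (simp add: ennreal_mult'[symmetric] exp_add[symmetric])
  also have "\<dots> \<le> ennreal (exp (- t * l + t\<^sup>2 * s\<^sup>2 * \<sigma>\<^sup>2 / 2))"
    using a by (intro ennreal_leI) (simp add: mult_left_mono mult_right_mono)
  also have "- t * l + t\<^sup>2 * s\<^sup>2 * \<sigma>\<^sup>2 / 2 = - l\<^sup>2 / (2 * \<sigma>\<^sup>2 * s\<^sup>2)"
    using \<sigma> s by (simp add: t_def field_simps power2_eq_square)
  finally show ?thesis by (simp add: emeasure_eq_measure)
qed

lemma tail:
  assumes a: "(\<Sum>i<n. (a i)\<^sup>2) \<le> s\<^sup>2" and s: "s > 0" and l: "l > 0"
  shows "prob {\<omega> \<in> space P. l < \<bar>lin a \<omega>\<bar>} \<le> 2 * exp (- l\<^sup>2 / (2 * \<sigma>\<^sup>2 * s\<^sup>2))"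
proof -
  have neg: "lin (\<lambda>i. - a i) \<omega> = - lin a \<omega>" for \<omega> using lin_scale[of "-1" a] by simp
  have "prob {\<omega> \<in> space P. l < \<bar>lin a \<omega>\<bar>}
      \<le> prob ({\<omega> \<in> space P. l \<le> lin a \<omega>} \<union> {\<omega> \<in> space P. l \<le> lin (\<lambda>i. - a i) \<omega>})"
    by (intro finite_measure_mono) (auto simp: neg)
  also have "\<dots> \<le> prob {\<omega> \<in> space P. l \<le> lin a \<omega>} + prob {\<omega> \<in> space P. l \<le> lin (\<lambda>i. - a i) \<omega>}"
    by (intro measure_Un_le) auto
  also have "\<dots> \<le> exp (- l\<^sup>2 / (2 * \<sigma>\<^sup>2 * s\<^sup>2)) + exp (- l\<^sup>2 / (2 * \<sigma>\<^sup>2 * s\<^sup>2))"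
    using a s l by (intro add_mono upper_tail) auto
  finally show ?thesis by simp
qed

text \<open>The exact value has 1 in place of 8. The loss is a factor 2 from
  \<open>square_le_two_exp\<close>, and a factor 4 from bounding two exponential moments
  \<open>exp (1 / 2)\<close> by 2 each.\<close>

lemma second_moment: "(\<integral>\<^sup>+\<omega>. ennreal ((lin a \<omega>)\<^sup>2) \<partial>P) \<le> ennreal (8 * \<sigma>\<^sup>2 * (\<Sum>i<n. (a i)\<^sup>2))"
proof (cases "(\<Sum>i<n. (a i)\<^sup>2) = 0")
  case True
  hence "\<forall>i<n. a i = 0" by (simp add: sum_nonneg_eq_0_iff)
  thus ?thesis by (simp add: lin_def)
next
  case False
  define S where "S = (\<Sum>i<n. (a i)\<^sup>2)"
  have S: "S > 0" using False sum_nonneg[of "{..<n}" "\<lambda>i. (a i)\<^sup>2"] unfolding S_def by auto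
  \<comment> \<open>Rescales \<open>lin a\<close> to unit variance.\<close>
  define s where "s = 1 / (\<sigma> * sqrt S)"
  have s2: "s\<^sup>2 * S * \<sigma>\<^sup>2 = 1" using S \<sigma> by (simp add: s_def power_divide power_mult_distrib)
  have "(lin a \<omega>)\<^sup>2 \<le> 2 * \<sigma>\<^sup>2 * S * (exp (s * lin a \<omega>) + exp (- s * lin a \<omega>))" for \<omega>
  proof -
    have "(lin a \<omega>)\<^sup>2 = \<sigma>\<^sup>2 * S * (s * lin a \<omega>)\<^sup>2" using s2 by (simp add: power_mult_distrib mult_ac)
    also have "\<dots> \<le> \<sigma>\<^sup>2 * S * (2 * (exp (s * lin a \<omega>) + exp (- (s * lin a \<omega>))))"
      using S by (intro mult_left_mono square_le_two_exp) auto
    finally show ?thesis by (simp add: algebra_simps)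
  qed
  hence "(\<integral>\<^sup>+\<omega>. ennreal ((lin a \<omega>)\<^sup>2) \<partial>P)
      \<le> (\<integral>\<^sup>+\<omega>. ennreal (2 * \<sigma>\<^sup>2 * S) * (ennreal (exp (s * lin a \<omega>)) + ennreal (exp (- s * lin a \<omega>))) \<partial>P)"
    using S by (intro nn_integral_mono) (simp add: ennreal_mult'[symmetric] ennreal_plus[symmetric] ennreal_leI del: ennreal_plus)
  also have "\<dots> = ennreal (2 * \<sigma>\<^sup>2 * S) * ((\<integral>\<^sup>+\<omega>. ennreal (exp (s * lin a \<omega>)) \<partial>P) + (\<integral>\<^sup>+\<omega>. ennreal (exp (- s * lin a \<omega>)) \<partial>P))"
    by (subst nn_integral_cmult, simp, subst nn_integral_add) auto
  also have "\<dots> = ennreal (2 * \<sigma>\<^sup>2 * S) * ennreal (2 * exp (1 / 2))"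
    unfolding mgf S_def[symmetric] using s2 by (simp add: ennreal_plus[symmetric] del: ennreal_plus)
  also have "\<dots> \<le> ennreal (2 * \<sigma>\<^sup>2 * S) * ennreal 4"
    using exp_half_le2 by (intro mult_left_mono ennreal_leI) auto
  also have "\<dots> = ennreal (8 * \<sigma>\<^sup>2 * S)"
    using S by (subst ennreal_mult'[symmetric]) auto
  finally show ?thesis by (simp add: S_def)
qed

lemma mult_noise_lin:
  assumes A: "A \<in> carrier_mat m n" and \<omega>: "\<omega> \<in> space P" and j: "j < m"
  shows "(A *\<^sub>v (Y \<omega> - \<mu>)) $ j = lin (\<lambda>i. A $$ (j, i)) \<omega>"
  using A j Y_carrier[OF \<omega>] \<mu> by (auto simp: lin_def scalar_prod_def lessThan_atLeast0 intro!: sum.cong)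

lemma l2_norm_sq_mult_noise:
  assumes A: "A \<in> carrier_mat m n" and \<omega>: "\<omega> \<in> space P"
  shows "(l2_norm (A *\<^sub>v (Y \<omega> - \<mu>)))\<^sup>2 = (\<Sum>j<m. (lin (\<lambda>i. A $$ (j, i)) \<omega>)\<^sup>2)"
proof -
  have "(l2_norm (A *\<^sub>v (Y \<omega> - \<mu>)))\<^sup>2 = (\<Sum>j<m. ((A *\<^sub>v (Y \<omega> - \<mu>)) $ j)\<^sup>2)"
    using A by (simp add: l2_norm_def scalar_prod_def power2_eq_square lessThan_atLeast0 sum_nonneg)
  thus ?thesis using mult_noise_lin[OF assms] by simp
qed

lemma l2_norm_sq_mult_noise_measurable:
  assumes A: "A \<in> carrier_mat m n"
  shows "(\<lambda>\<omega>. (l2_norm (A *\<^sub>v (Y \<omega> - \<mu>)))\<^sup>2) \<in> borel_measurable P"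
proof -
  have "(\<lambda>\<omega>. \<Sum>j<m. (lin (\<lambda>i. A $$ (j, i)) \<omega>)\<^sup>2) \<in> borel_measurable P" by measurable
  thus ?thesis using l2_norm_sq_mult_noise[OF A] by (subst measurable_cong) auto
qed

text \<open>Markov's inequality, \<open>F\<close> being the squared Frobenius norm of
  \<open>A\<close>. The strict inequality keeps the bound true for \<open>F = 0\<close>, where the
  event is empty.\<close>

lemma prob_l2_norm_sq_mult_noise:
  fixes A :: "real mat"
  assumes A: "A \<in> carrier_mat m n" and C: "C > 0"
  defines "F \<equiv> \<Sum>j<m. \<Sum>i<n. (A $$ (j, i))\<^sup>2"
  shows "prob {\<omega> \<in> space P. C * F < (l2_norm (A *\<^sub>v (Y \<omega> - \<mu>)))\<^sup>2} \<le> 8 * \<sigma>\<^sup>2 / C"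
proof -
  define Z where "Z \<omega> = (\<Sum>j<m. (lin (\<lambda>i. A $$ (j, i)) \<omega>)\<^sup>2)" for \<omega>
  have Z: "(l2_norm (A *\<^sub>v (Y \<omega> - \<mu>)))\<^sup>2 = Z \<omega>" if "\<omega> \<in> space P" for \<omega>
    using l2_norm_sq_mult_noise[OF A that] by (simp add: Z_def)
  have [measurable]: "Z \<in> borel_measurable P" unfolding Z_def [abs_def] by measurable
  have set: "{\<omega> \<in> space P. C * F < (l2_norm (A *\<^sub>v (Y \<omega> - \<mu>)))\<^sup>2} = {\<omega> \<in> space P. C * F < Z \<omega>}"
    using Z by auto
  have F0: "F \<ge> 0" by (simp add: F_def sum_nonneg)
  show ?thesis
  proof (cases "F = 0")
    case True
    hence "\<forall>j<m. \<forall>i<n. A $$ (j, i) = 0"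
      unfolding F_def by (simp add: sum_nonneg_eq_0_iff sum_nonneg)
    hence "Z \<omega> = 0" for \<omega> by (simp add: Z_def lin_def)
    thus ?thesis unfolding set using C True by simp
  next
    case False
    hence F: "F > 0" using F0 by simp
    have "emeasure P {\<omega> \<in> space P. C * F < Z \<omega>} \<le> emeasure P {\<omega> \<in> space P. 1 \<le> ennreal (1 / (C * F)) * ennreal (Z \<omega>)}"
    proof (intro emeasure_mono subsetI)
      fix \<omega> assume "\<omega> \<in> {\<omega> \<in> space P. C * F < Z \<omega>}"
      hence "\<omega> \<in> space P" "1 \<le> 1 / (C * F) * Z \<omega>" using C F by (auto simp: field_simps)
      thus "\<omega> \<in> {\<omega> \<in> space P. 1 \<le> ennreal (1 / (C * F)) * ennreal (Z \<omega>)}"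
        using C F by (simp add: ennreal_mult'[symmetric])
    qed measurable
    also have "\<dots> \<le> ennreal (1 / (C * F)) * (\<integral>\<^sup>+\<omega>. ennreal (Z \<omega>) * indicator (space P) \<omega> \<partial>P)"
      by (rule nn_integral_Markov_inequality) auto
    also have "(\<integral>\<^sup>+\<omega>. ennreal (Z \<omega>) * indicator (space P) \<omega> \<partial>P)
        = (\<integral>\<^sup>+\<omega>. (\<Sum>j<m. ennreal ((lin (\<lambda>i. A $$ (j, i)) \<omega>)\<^sup>2)) \<partial>P)"
      by (intro nn_integral_cong) (simp add: Z_def)
    also have "\<dots> = (\<Sum>j<m. \<integral>\<^sup>+\<omega>. ennreal ((lin (\<lambda>i. A $$ (j, i)) \<omega>)\<^sup>2) \<partial>P)"
      by (intro nn_integral_sum) measurable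
    also have "\<dots> \<le> (\<Sum>j<m. ennreal (8 * \<sigma>\<^sup>2 * (\<Sum>i<n. (A $$ (j, i))\<^sup>2)))"
      by (intro sum_mono second_moment)
    also have "\<dots> = ennreal (8 * \<sigma>\<^sup>2 * F)"
      by (subst sum_ennreal) (auto simp: F_def sum_distrib_left sum_nonneg)
    also have "ennreal (1 / (C * F)) * \<dots> = ennreal (8 * \<sigma>\<^sup>2 / C)"
      using C F by (simp add: ennreal_mult'[symmetric])
    finally show ?thesis
      unfolding set using C by (simp add: emeasure_eq_measure mult_left_mono)
  qed
qed

end

section \<open>Lipschitz dependence of the estimate on the data\<close>

text \<open>Comparison with the midpoint of \<open>b\<close> and \<open>b'\<close> only, which avoids a limit and costs just a constant
  compared with the exact variational inequality.\<close>

lemma gen_lasso_midpoint_inequality: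
  assumes est: "gen_lasso_estimate D lam y b" and D: "D \<in> carrier_mat r n" and lam: "0 \<le> lam"
    and y: "y \<in> carrier_vec n" and b': "b' \<in> carrier_vec n"
  shows "(y - b) \<bullet> (b' - b) \<le> lam * l1_norm (D *\<^sub>v b') - lam * l1_norm (D *\<^sub>v b) + (l2_norm (b' - b))\<^sup>2 / 4"
proof -
  note b = gen_lasso_estimateD(1)[OF est D]
  define m where "m = (1/2) \<cdot>\<^sub>v (b + b')"
  have m: "m \<in> carrier_vec n" using b b' by (simp add: m_def)
  have w: "b' - b \<in> carrier_vec n" using b b' by simp
  have "y - m = (y - b) - (1/2) \<cdot>\<^sub>v (b' - b)"
    using y b b' by (auto simp: m_def field_simps)
  hence "(l2_norm (y - m))\<^sup>2
      = (l2_norm (y - b))\<^sup>2 - (y - b) \<bullet> (b' - b) + (l2_norm ((1/2) \<cdot>\<^sub>v (b' - b)))\<^sup>2"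
    using y b w by (simp add: l2_norm_sq_diff[of _ n] scalar_prod_smult_right)
  also have "(l2_norm ((1/2) \<cdot>\<^sub>v (b' - b)))\<^sup>2 = (l2_norm (b' - b))\<^sup>2 / 4"
    by (simp add: l2_norm_sq_sum sum_divide_distrib power_mult_distrib power_divide)
  finally have quad: "(l2_norm (y - m))\<^sup>2
      = (l2_norm (y - b))\<^sup>2 - (y - b) \<bullet> (b' - b) + (l2_norm (b' - b))\<^sup>2 / 4" .
  have "D *\<^sub>v m = (1/2) \<cdot>\<^sub>v (D *\<^sub>v b + D *\<^sub>v b')"
    using D b b' by (simp add: m_def mult_mat_vec mult_add_distrib_mat_vec)
  hence "l1_norm (D *\<^sub>v m) = (\<Sum>j<r. \<bar>(D *\<^sub>v b) $ j + (D *\<^sub>v b') $ j\<bar> / 2)"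
    using D b b' by (auto simp: l1_norm_def abs_mult intro!: sum.cong)
  also have "\<dots> \<le> (\<Sum>j<r. (\<bar>(D *\<^sub>v b) $ j\<bar> + \<bar>(D *\<^sub>v b') $ j\<bar>) / 2)"
    by (intro sum_mono divide_right_mono) auto
  also have "\<dots> = (l1_norm (D *\<^sub>v b) + l1_norm (D *\<^sub>v b')) / 2"
    using D by (simp add: l1_norm_def sum_divide_distrib[symmetric] sum.distrib)
  finally have "lam * l1_norm (D *\<^sub>v m) \<le> lam * ((l1_norm (D *\<^sub>v b) + l1_norm (D *\<^sub>v b')) / 2)"
    using lam by (intro mult_left_mono)
  thus ?thesis
    using gen_lasso_estimateD(2)[OF est D m] quad by (simp add: gen_lasso_objective_def field_simps)
qed

text \<open>In the sum of the midpoint inequalities for the two estimates the penalties cancel,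
  leaving |b - b'|^2 / 2 \<le> (y - y') . (b - b'). Young's inequality finishes the proof.\<close>

lemma gen_lasso_estimate_lipschitz:
  assumes est: "gen_lasso_estimate D lam y b" and est': "gen_lasso_estimate D lam y' b'"
    and D: "D \<in> carrier_mat r n" and lam: "0 \<le> lam"
    and y: "y \<in> carrier_vec n" and y': "y' \<in> carrier_vec n"
  shows "l2_norm (b - b') \<le> 2 * l2_norm (y - y')"
proof -
  note b = gen_lasso_estimateD(1)[OF est D] and b' = gen_lasso_estimateD(1)[OF est' D]
  have sq: "(l2_norm (b' - b))\<^sup>2 = (l2_norm (b - b'))\<^sup>2"
    using b b' by (simp add: l2_norm_sq_sum power2_commute)
  have "(y - b) \<bullet> (b' - b) + (y' - b') \<bullet> (b - b') = (l2_norm (b - b'))\<^sup>2 - (y - y') \<bullet> (b - b')"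
    using y y' b b'
    by (simp add: l2_norm_sq minus_scalar_prod_distrib[of _ n] scalar_prod_minus_distrib[of _ n])
  hence "(l2_norm (b - b'))\<^sup>2 / 2 \<le> (y - y') \<bullet> (b - b')"
    using gen_lasso_midpoint_inequality[OF est D lam y b'] gen_lasso_midpoint_inequality[OF est' D lam y' b] sq
    by linarith
  also have "\<dots> \<le> (l2_norm (y - y'))\<^sup>2 + (l2_norm (b - b'))\<^sup>2 / 4"
    using y y' b b' by (intro scalar_prod_le_young[of _ n]) auto
  finally have "(l2_norm (b - b'))\<^sup>2 \<le> (2 * l2_norm (y - y'))\<^sup>2" by (simp add: power_mult_distrib)
  thus ?thesis by (rule power2_le_imp_le) (simp add: l2_norm_nonneg)
qed

section \<open>Measurability and error probability of the estimate\<close>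

lemma l2_norm_le_sum_abs: "l2_norm v \<le> (\<Sum>i<dim_vec v. \<bar>v $ i\<bar>)"
proof -
  have "l2_norm v = L2_set (\<lambda>i. v $ i) {..<dim_vec v}"
    by (simp add: l2_norm_def L2_set_def scalar_prod_def power2_eq_square lessThan_atLeast0)
  thus ?thesis using L2_set_le_sum_abs by metis
qed

lemma abs_index_le_l2_norm:
  assumes "i < dim_vec v"
  shows "\<bar>v $ i\<bar> \<le> l2_norm v"
proof (rule power2_le_imp_le)
  show "\<bar>v $ i\<bar>\<^sup>2 \<le> (l2_norm v)\<^sup>2"
    using assms member_le_sum[of i "{..<dim_vec v}" "\<lambda>i. (v $ i)\<^sup>2"] by (simp add: l2_norm_sq_sum)
qed (rule l2_norm_nonneg)

lemma l2_norm_col_le_max_col_norm: "j < dim_col B \<Longrightarrow> l2_norm (col B j) \<le> max_col_norm B"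
  unfolding max_col_norm_def by (intro Max_ge) auto

text \<open>\<open>est\<close> is any pointwise choice of minimizers; its measurability is derived,
  not assumed. With \<open>r \<ge> 1\<close> the maximum in \<open>M\<close> is over a nonempty set
  and \<open>ln (real r)\<close> is nonnegative.\<close>

locale gaussian_gen_lasso = normal_noise P n \<mu> \<sigma> Y + moore_penrose_pair r n D Dp
  for P :: "'w measure" and n r \<mu> \<sigma> Y D Dp +
  fixes M lam :: real and est :: "'w \<Rightarrow> real vec"
  assumes r: "r \<ge> 1" and M: "M = max_col_norm Dp"
    and lam: "lam = 2 * \<sigma> * (M * sqrt (ln (real r)))"
    and est: "\<And>\<omega>. \<omega> \<in> space P \<Longrightarrow> gen_lasso_estimate D lam (Y \<omega>) (est \<omega>)"
begin

lemma M_nonneg: "0 \<le> M"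
  using l2_norm_col_le_max_col_norm[of 0 Dp] Dp r M l2_norm_nonneg[of "col Dp 0"] by auto

lemma lam_nonneg: "0 \<le> lam"
  using M_nonneg \<sigma> r by (simp add: lam)

lemma est_carrier: "\<omega> \<in> space P \<Longrightarrow> est \<omega> \<in> carrier_vec n"
  using gen_lasso_estimateD(1)[OF est D] .

lemma est_measurable:
  assumes i: "i < n"
  shows "(\<lambda>\<omega>. est \<omega> $ i) \<in> borel_measurable P"
proof (rule borel_measurable_if_oscillation_dominated)
  \<comment> \<open>The Lipschitz constant 2 is moved into the coordinates, because the oscillation
    bound has constant 1.\<close>
  show "(\<lambda>\<omega>. 2 * Y \<omega> $ j) \<in> borel_measurable P" if "j < n" for j
    using Y_measurable[OF that] by simp
  fix \<omega> \<omega>' assume \<omega>: "\<omega> \<in> space P" "\<omega>' \<in> space P"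
  have "est \<omega> $ i - est \<omega>' $ i \<le> \<bar>(est \<omega> - est \<omega>') $ i\<bar>"
    using i \<omega>[THEN est_carrier] by simp
  also have "\<dots> \<le> l2_norm (est \<omega> - est \<omega>')"
    using i \<omega>[THEN est_carrier] by (intro abs_index_le_l2_norm) simp
  also have "\<dots> \<le> 2 * l2_norm (Y \<omega> - Y \<omega>')"
    using \<omega> by (intro gen_lasso_estimate_lipschitz[OF est est D lam_nonneg] Y_carrier)
  also have "l2_norm (Y \<omega> - Y \<omega>') \<le> (\<Sum>j<n. \<bar>Y \<omega> $ j - Y \<omega>' $ j\<bar>)"
    using l2_norm_le_sum_abs[of "Y \<omega> - Y \<omega>'"] \<omega>[THEN Y_carrier] by simp
  finally show "est \<omega> $ i - est \<omega>' $ i \<le> (\<Sum>j<n. \<bar>2 * Y \<omega> $ j - 2 * Y \<omega>' $ j\<bar>)"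
    by (simp add: sum_distrib_left abs_mult right_diff_distrib[symmetric] del: right_diff_distrib_numeral)
qed

lemma error_measurable: "(\<lambda>\<omega>. (l2_norm (est \<omega> - \<mu>))\<^sup>2) \<in> borel_measurable P"
proof -
  have "(\<lambda>\<omega>. \<Sum>i<n. (est \<omega> $ i - \<mu> $ i)\<^sup>2) \<in> borel_measurable P"
    using est_measurable by (intro borel_measurable_sum borel_measurable_power borel_measurable_diff) auto
  thus ?thesis
    using est_carrier \<mu> by (subst measurable_cong) (auto simp: l2_norm_sq_sum)
qed

text \<open>The rows of \<open>Dp\<^sup>T\<close> have norm at most \<open>M\<close>, so the choice
  of \<open>lam\<close> makes each coordinate exceed it with probability at most 2 / r^2. The union
  bound costs a factor \<open>r\<close>.\<close>

lemma prob_noise_exceeds: "prob {\<omega> \<in> space P. \<exists>j<r. lam < \<bar>(Dp\<^sup>T *\<^sub>v (Y \<omega> - \<mu>)) $ j\<bar>} \<le> 2 / real r"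
\<comment> \<open>Here \<open>ln (real r) = 0\<close> gives \<open>lam = 0\<close>, outside the
  scope of \<open>tail\<close>, but the claimed bound is 2.\<close>
proof (cases "r = 1")
  case True
  thus ?thesis using prob_le_1 by (auto intro: order_trans)
next
  case False
  with r have r2: "r \<ge> 2" by simp
  let ?a = "\<lambda>j i. Dp\<^sup>T $$ (j, i)"
  have DpT: "Dp\<^sup>T \<in> carrier_mat r n" using Dp by simp
  have a: "(\<Sum>i<n. (?a j i)\<^sup>2) \<le> M\<^sup>2" if "j < r" for j
  proof -
    have "(\<Sum>i<n. (?a j i)\<^sup>2) = (l2_norm (col Dp j))\<^sup>2" using Dp that by (simp add: l2_norm_sq_sum)
    also have "\<dots> \<le> M\<^sup>2"
      unfolding M
      using Dp that by (intro power_mono l2_norm_nonneg l2_norm_col_le_max_col_norm) auto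
    finally show ?thesis .
  qed
  have each: "prob {\<omega> \<in> space P. lam < \<bar>lin (?a j) \<omega>\<bar>} \<le> 2 / (real r)\<^sup>2" if j: "j < r" for j
  \<comment> \<open>\<open>tail\<close> requires a positive scale. For \<open>M = 0\<close> the
    linear form vanishes and cannot exceed \<open>lam \<ge> 0\<close>.\<close>
  proof (cases "M = 0")
    case True
    hence "(\<Sum>i<n. (?a j i)\<^sup>2) = 0" using a[OF j] by (simp add: sum_nonneg antisym)
    hence "\<forall>i<n. ?a j i = 0" by (simp add: sum_nonneg_eq_0_iff)
    hence "lin (?a j) \<omega> = 0" for \<omega> by (simp add: lin_def)
    thus ?thesis using lam_nonneg by simp
  next
    case False
    hence M0: "M > 0" using M_nonneg by simp
    have ln: "ln (real r) > 0" using r2 by simp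
    have "prob {\<omega> \<in> space P. lam < \<bar>lin (?a j) \<omega>\<bar>} \<le> 2 * exp (- lam\<^sup>2 / (2 * \<sigma>\<^sup>2 * M\<^sup>2))"
      using a[OF j] M0 \<sigma> ln by (intro tail) (auto simp: lam)
    also have "- lam\<^sup>2 / (2 * \<sigma>\<^sup>2 * M\<^sup>2) = - (2 * ln (real r))"
      using M0 \<sigma> ln by (simp add: lam power_mult_distrib)
    also have "exp (- (2 * ln (real r))) = 1 / (real r)\<^sup>2"
    proof -
      have "exp (2 * ln (real r)) = (real r)\<^sup>2" using r2 exp_of_nat_mult[of 2 "ln (real r)"] by simp
      thus ?thesis by (simp add: exp_minus divide_inverse)
    qed
    finally show ?thesis by simp
  qed
  have "{\<omega> \<in> space P. \<exists>j<r. lam < \<bar>(Dp\<^sup>T *\<^sub>v (Y \<omega> - \<mu>)) $ j\<bar>}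
      = (\<Union>j<r. {\<omega> \<in> space P. lam < \<bar>lin (?a j) \<omega>\<bar>})"
    using mult_noise_lin[OF DpT] by auto
  also have "prob \<dots> \<le> (\<Sum>j<r. prob {\<omega> \<in> space P. lam < \<bar>lin (?a j) \<omega>\<bar>})"
    by (intro finite_measure_subadditive_finite) auto
  also have "\<dots> \<le> (\<Sum>j<r. 2 / (real r)\<^sup>2)" by (intro sum_mono each) auto
  also have "\<dots> = 2 / real r" using r by (simp add: power2_eq_square)
  finally show ?thesis .
qed

lemma noise_exceeds_event: "{\<omega> \<in> space P. \<exists>j<r. lam < \<bar>(Dp\<^sup>T *\<^sub>v (Y \<omega> - \<mu>)) $ j\<bar>} \<in> events"
proof -
  have DpT: "Dp\<^sup>T \<in> carrier_mat r n" using Dp by simp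
  have "{\<omega> \<in> space P. \<exists>j<r. lam < \<bar>(Dp\<^sup>T *\<^sub>v (Y \<omega> - \<mu>)) $ j\<bar>}
      = (\<Union>j<r. {\<omega> \<in> space P. lam < \<bar>lin (\<lambda>i. Dp\<^sup>T $$ (j, i)) \<omega>\<bar>})"
    using mult_noise_lin[OF DpT] by auto
  thus ?thesis by simp
qed

lemma prob_ge_one_minus:
  assumes "B \<in> events" "G \<in> events" "prob B \<le> p" "space P - B \<subseteq> G"
  shows "1 - p \<le> prob G"
  using assms prob_compl[of B] finite_measure_mono[of "space P - B" G] by linarith

text \<open>With at least \<open>4 / \<delta>\<close> rows, the oracle bound fails through the row
  noise or through the null-space noise, each with probability at most \<open>\<delta> / 2\<close>.
  Otherwise \<open>r\<close> is at most half of \<open>n\<close>, the nullity is at least half of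
  \<open>n\<close>, and the crude bound suffices.\<close>

lemma prob_error_bound:
  assumes \<delta>: "\<delta> > 0" and size: "4 / \<delta> \<le> real r \<or> 2 * real r \<le> real n"
  shows "1 - \<delta> \<le> prob {\<omega> \<in> space P. (l2_norm (est \<omega> - \<mu>))\<^sup>2
    \<le> (128 * \<sigma>\<^sup>2 / \<delta> + 16 * \<sigma>) * (real (kernel_dim D) + M * sqrt (ln (real r)) * l1_norm (D *\<^sub>v \<mu>))}"
    (is "_ \<le> prob ?G")
proof -
  \<comment> \<open>Chosen so that Markov's bound \<open>8 * \<sigma>\<^sup>2 / C\<close> equals
    \<open>\<delta> / 2\<close>.\<close>
  define C where "C = 16 * \<sigma>\<^sup>2 / \<delta>"
  define k where "k = real (kernel_dim D)"
  define T where "T = M * sqrt (ln (real r)) * l1_norm (D *\<^sub>v \<mu>)"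
  have C: "C > 0" and C2: "8 * \<sigma>\<^sup>2 / C = \<delta> / 2" using \<sigma> \<delta> by (auto simp: C_def)
  have T: "T \<ge> 0" using M_nonneg r l1_norm_nonneg by (simp add: T_def)
  have k: "k \<ge> 0" by (simp add: k_def)
  have lamT: "lam * l1_norm (D *\<^sub>v \<mu>) = 2 * \<sigma> * T" by (simp add: lam T_def)
  \<comment> \<open>The constant is \<open>8 * C + 16 * \<sigma>\<close>, which serves both cases:
    the oracle bound gives \<open>4 * C * k + 16 * \<sigma> * T\<close> and the crude one
    \<open>8 * C * k + 8 * \<sigma> * T\<close>. The remaining products are nonnegative.\<close>
  have G: "?G = {\<omega> \<in> space P. (l2_norm (est \<omega> - \<mu>))\<^sup>2 \<le> 8 * C * k + 8 * C * T + 16 * \<sigma> * k + 16 * \<sigma> * T}"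
    by (simp add: C_def k_def T_def algebra_simps add_divide_distrib)
  have Ge: "?G \<in> events" using error_measurable by measurable
  have pos: "0 \<le> C * k" "0 \<le> C * T" "0 \<le> \<sigma> * k" "0 \<le> \<sigma> * T" using C T k \<sigma> by auto
  show ?thesis
  proof (cases "4 / \<delta> \<le> real r")
    case True
    let ?B1 = "{\<omega> \<in> space P. \<exists>j<r. lam < \<bar>(Dp\<^sup>T *\<^sub>v (Y \<omega> - \<mu>)) $ j\<bar>}"
    let ?B2 = "{\<omega> \<in> space P. C * k < (l2_norm (null_proj *\<^sub>v (Y \<omega> - \<mu>)))\<^sup>2}"
    have e2: "?B2 \<in> events" using l2_norm_sq_mult_noise_measurable[OF null_proj] by measurable
    have "2 / real r \<le> \<delta> / 2" using True \<delta> r by (simp add: field_simps)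
    hence "prob ?B1 \<le> \<delta> / 2" using prob_noise_exceeds by linarith
    moreover have "prob ?B2 \<le> \<delta> / 2"
      using prob_l2_norm_sq_mult_noise[OF null_proj C] frobenius_null_proj C2 by (simp add: k_def)
    ultimately have "prob (?B1 \<union> ?B2) \<le> \<delta>"
      using measure_Un_le[OF noise_exceeds_event e2] by linarith
    moreover have "space P - (?B1 \<union> ?B2) \<subseteq> ?G"
    proof
      fix \<omega> assume "\<omega> \<in> space P - (?B1 \<union> ?B2)"
      hence \<omega>: "\<omega> \<in> space P" and n1: "\<And>j. j < r \<Longrightarrow> \<bar>(Dp\<^sup>T *\<^sub>v (Y \<omega> - \<mu>)) $ j\<bar> \<le> lam"
        and n2: "(l2_norm (null_proj *\<^sub>v (Y \<omega> - \<mu>)))\<^sup>2 \<le> C * k" by force+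
      have "(l2_norm (est \<omega> - \<mu>))\<^sup>2 \<le> 4 * (C * k) + 8 * (lam * l1_norm (D *\<^sub>v \<mu>))"
        using gen_lasso_oracle_bound[OF est[OF \<omega>] Y_carrier[OF \<omega>] \<mu> lam_nonneg n1] n2 by simp
      thus "\<omega> \<in> ?G" unfolding G using \<omega> pos lamT by simp
    qed
    ultimately show ?thesis
      by (rule prob_ge_one_minus[OF sets.Un[OF noise_exceeds_event e2] Ge])
  next
    case False
    hence nk: "real n \<le> 2 * k" using size kernel_dim_ge by (simp add: k_def)
    \<comment> \<open>The identity matrix makes the whole noise an instance of the Frobenius bound,
      with squared norm \<open>n\<close>.\<close>
    have I: "1\<^sub>m n \<in> carrier_mat n n" by simp
    let ?B = "{\<omega> \<in> space P. C * real n < (l2_norm (1\<^sub>m n *\<^sub>v (Y \<omega> - \<mu>)))\<^sup>2}"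
    have e: "?B \<in> events" using l2_norm_sq_mult_noise_measurable[OF I] by measurable
    have "(\<Sum>j<n. \<Sum>i<n. ((1\<^sub>m n :: real mat) $$ (j, i))\<^sup>2) = (\<Sum>j<n. \<Sum>i<n. if j = i then 1 else 0)"
      by (intro sum.cong) auto
    hence "(\<Sum>j<n. \<Sum>i<n. ((1\<^sub>m n :: real mat) $$ (j, i))\<^sup>2) = real n" by simp
    hence "prob ?B \<le> \<delta> / 2" using prob_l2_norm_sq_mult_noise[OF I C] C2 by simp
    hence "prob ?B \<le> \<delta>" using \<delta> by simp
    moreover have "space P - ?B \<subseteq> ?G"
    proof
      fix \<omega> assume "\<omega> \<in> space P - ?B"
      hence \<omega>: "\<omega> \<in> space P" and "(l2_norm (1\<^sub>m n *\<^sub>v (Y \<omega> - \<mu>)))\<^sup>2 \<le> C * real n" by force+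
      moreover have "Y \<omega> - \<mu> \<in> carrier_vec n" using Y_carrier[OF \<omega>] \<mu> by simp
      ultimately have "(l2_norm (Y \<omega> - \<mu>))\<^sup>2 \<le> C * real n" by simp
      also have "\<dots> \<le> C * (2 * k)" using nk C by (intro mult_left_mono) auto
      finally have "(l2_norm (est \<omega> - \<mu>))\<^sup>2 \<le> 8 * (C * k) + 4 * (lam * l1_norm (D *\<^sub>v \<mu>))"
        using gen_lasso_crude_bound[OF est[OF \<omega>] D Y_carrier[OF \<omega>] \<mu> lam_nonneg] by simp
      thus "\<omega> \<in> ?G" unfolding G using \<omega> pos lamT by simp
    qed
    ultimately show ?thesis by (rule prob_ge_one_minus[OF e Ge])
  qed
qed

end

section \<open>Choice of constants for the asymptotic statement\<close>

theorem theorem3: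
  fixes \<sigma> :: real
  assumes "\<sigma> > 0"
  shows "\<exists>c>0. \<forall>(P :: nat \<Rightarrow> 'w measure) (y :: nat \<Rightarrow> 'w \<Rightarrow> real vec) (\<beta>0 :: nat \<Rightarrow> real vec)
           (r :: nat \<Rightarrow> nat) (D :: nat \<Rightarrow> real mat) (Dp :: nat \<Rightarrow> real mat)
           (M :: nat \<Rightarrow> real) (lam :: nat \<Rightarrow> real) (\<beta>h :: nat \<Rightarrow> 'w \<Rightarrow> real vec).
           (\<forall>n. \<beta>0 n \<in> carrier_vec n \<and> isotropic_normal (P n) n (\<beta>0 n) \<sigma> (y n)) \<longrightarrow>
           (\<forall>n. r n \<ge> 1 \<and> D n \<in> carrier_mat (r n) n \<and> moore_penrose (D n) (Dp n)) \<longrightarrow>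
           (\<forall>n. M n = max_col_norm (Dp n)) \<longrightarrow>
           (\<forall>n. lam n = c * (M n * sqrt (ln (real (r n))))) \<longrightarrow>
           (\<forall>n. \<forall>\<omega>\<in>space (P n). gen_lasso_estimate (D n) (lam n) (y n \<omega>) (\<beta>h n \<omega>)) \<longrightarrow>
           bigO_in_prob P (\<lambda>n \<omega>. (l2_norm (\<beta>h n \<omega> - \<beta>0 n))\<^sup>2 / real n)
             (\<lambda>n. real (kernel_dim (D n)) / real n
                  + M n * sqrt (ln (real (r n))) / real n * l1_norm (D n *\<^sub>v \<beta>0 n))"
proof (intro exI[of _ "2 * \<sigma>"] conjI allI impI)
  \<comment> \<open>The factor \<open>2 * \<sigma>\<close> makes the tail of each coordinate of
    order 1 / r^2, which survives the union bound over \<open>r\<close> coordinates.\<close>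
  show "0 < 2 * \<sigma>" using assms by simp
  fix P :: "nat \<Rightarrow> 'w measure" and y :: "nat \<Rightarrow> 'w \<Rightarrow> real vec" and \<beta>0 :: "nat \<Rightarrow> real vec"
    and r :: "nat \<Rightarrow> nat" and D Dp :: "nat \<Rightarrow> real mat" and M lam :: "nat \<Rightarrow> real"
    and \<beta>h :: "nat \<Rightarrow> 'w \<Rightarrow> real vec"
  assume hyps: "\<forall>n. \<beta>0 n \<in> carrier_vec n \<and> isotropic_normal (P n) n (\<beta>0 n) \<sigma> (y n)"
    "\<forall>n. r n \<ge> 1 \<and> D n \<in> carrier_mat (r n) n \<and> moore_penrose (D n) (Dp n)"
    "\<forall>n. M n = max_col_norm (Dp n)"
    "\<forall>n. lam n = 2 * \<sigma> * (M n * sqrt (ln (real (r n))))"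
    "\<forall>n. \<forall>\<omega>\<in>space (P n). gen_lasso_estimate (D n) (lam n) (y n \<omega>) (\<beta>h n \<omega>)"
  show "bigO_in_prob P (\<lambda>n \<omega>. (l2_norm (\<beta>h n \<omega> - \<beta>0 n))\<^sup>2 / real n)
    (\<lambda>n. real (kernel_dim (D n)) / real n + M n * sqrt (ln (real (r n))) / real n * l1_norm (D n *\<^sub>v \<beta>0 n))"
    unfolding bigO_in_prob_def
  proof (intro allI impI)
    fix \<delta> :: real assume \<delta>: "\<delta> > 0"
    let ?K = "128 * \<sigma>\<^sup>2 / \<delta> + 16 * \<sigma>"
    let ?G = "\<lambda>n. {\<omega> \<in> space (P n). \<bar>(l2_norm (\<beta>h n \<omega> - \<beta>0 n))\<^sup>2 / real n\<bar>
      \<le> ?K * (real (kernel_dim (D n)) / real n + M n * sqrt (ln (real (r n))) / real n * l1_norm (D n *\<^sub>v \<beta>0 n))}"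
    \<comment> \<open>From \<open>8 / \<delta>\<close> on, one of the two regimes applies:
      \<open>r n < 4 / \<delta>\<close> implies \<open>2 * r n < 8 / \<delta> \<le> n\<close>. The
      maximum with 1 permits cancelling the division by \<open>n\<close>.\<close>
    have "1 - \<delta> \<le> measure (P n) (?G n)" if n: "n \<ge> max 1 (nat \<lceil>8 / \<delta>\<rceil>)" for n
    proof -
      interpret gaussian_gen_lasso "P n" n "r n" "\<beta>0 n" \<sigma> "y n" "D n" "Dp n" "M n" "lam n" "\<beta>h n"
        using hyps assms by unfold_locales auto
      have n1: "real n > 0" using n by simp
      have "8 / \<delta> \<le> real n" using n by linarith
      hence size: "4 / \<delta> \<le> real (r n) \<or> 2 * real (r n) \<le> real n" by linarith
      have "?K * (real (kernel_dim (D n)) / real n + M n * sqrt (ln (real (r n))) / real n * l1_norm (D n *\<^sub>v \<beta>0 n))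
          = ?K * (real (kernel_dim (D n)) + M n * sqrt (ln (real (r n))) * l1_norm (D n *\<^sub>v \<beta>0 n)) / real n"
        by (simp add: add_divide_distrib distrib_left)
      hence "?G n = {\<omega> \<in> space (P n). (l2_norm (\<beta>h n \<omega> - \<beta>0 n))\<^sup>2
          \<le> ?K * (real (kernel_dim (D n)) + M n * sqrt (ln (real (r n))) * l1_norm (D n *\<^sub>v \<beta>0 n))}"
        using n1 by (simp add: divide_le_cancel)
      thus ?thesis using prob_error_bound[OF \<delta> size] by simp
    qed
    hence "\<forall>\<^sub>F n in sequentially. 1 - \<delta> \<le> measure (P n) (?G n)"
      by (intro eventually_sequentiallyI)
    moreover have "?K > 0" using assms \<delta> by (simp add: add_pos_pos)
    ultimately show "\<exists>K>0. \<forall>\<^sub>F n in sequentially. 1 - \<delta> \<le> measure (P n)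
      {\<omega> \<in> space (P n). \<bar>(l2_norm (\<beta>h n \<omega> - \<beta>0 n))\<^sup>2 / real n\<bar>
        \<le> K * (real (kernel_dim (D n)) / real n + M n * sqrt (ln (real (r n))) / real n * l1_norm (D n *\<^sub>v \<beta>0 n))}"
      by blast
  qed
qed

end
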